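(* Let $P\neq\emptyset$ be a classical transportation polytope of size $p\times 2$ with $n\le 2p$ facets. Then the dimension of $P$ is $d=p-1$ and the diameter of the graph of $P$ is at most $n-d$.
   Context: The $p\times q$ classical transportation polytope with marginals $u\in\mathbb{R}^p$, $v\in\mathbb{R}^q$ is $\{x\in\mathbb{R}_{\ge0}^{p\times q}: \sum_j x_{i,j}=u_i\ \forall i,\ \sum_i x_{i,j}=v_j\ \forall j\}$. The graph of a polytope has its vertices as nodes and its edges as edges; its diameter is the maximum shortest-path distance between two vertices.
   Formalization: The marginals u and v are assumed entrywise positive; without this the dimension claim fails, e.g. u=(1,1), v=(2,0) gives a single point of dimension 0 instead of p-1=1. *)

theory Defs
  imports "HOL-Analysis.Analysis" "Graph_Theory.Graph_Theory"
begin

text \<open>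
  The index types play the role of the two index sets, so a polytope of size \<open>p \<times> q\<close> has
  \<open>p = CARD('p)\<close> and \<open>q = CARD('q)\<close>; entry \<open>(i,j)\<close> is \<open>x $ i $ j\<close>. As usual for classical
  transportation polytopes, the marginals of interest are positive; positivity is a
  separate predicate because the set itself makes sense for arbitrary vectors.
\<close>

definition transportation_polytope ::
    "real ^ 'p \<Rightarrow> real ^ 'q \<Rightarrow> (real ^ 'q ^ 'p) set" where
  "transportation_polytope u v =
     {x. (\<forall>i j. 0 \<le> x $ i $ j) \<and>
         (\<forall>i. (\<Sum>j\<in>UNIV. x $ i $ j) = u $ i) \<and>
         (\<forall>j. (\<Sum>i\<in>UNIV. x $ i $ j) = v $ j)}"

definition positive_vec :: "real ^ 'n \<Rightarrow> bool" where
  "positive_vec w \<longleftrightarrow> (\<forall>i. 0 < w $ i)"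

text \<open>
  An undirected edge is represented by its two opposite arcs.
\<close>

definition polytope_graph ::
    "'a::euclidean_space set \<Rightarrow> ('a, 'a \<times> 'a) pre_digraph" where
  "polytope_graph P = with_proj
     \<lparr>pverts = {x. x extreme_point_of P},
      parcs = {(x, y). x extreme_point_of P \<and> y extreme_point_of P \<and>
                       closed_segment x y edge_of P}\<rparr>"

text \<open>
  The graph distance is \<^const>\<open>wf_digraph.\<mu>\<close> with unit arc costs; it is \<open>\<infinity>\<close> between vertices
  not joined by a walk, so a finite bound on the diameter includes connectedness.
\<close>

definition graph_diameter :: "('a, 'b) pre_digraph \<Rightarrow> ereal" where
  "graph_diameter G =
     (SUP x\<in>verts G. SUP y\<in>verts G. wf_digraph.\<mu> G (\<lambda>_. 1) x y)"

end

theory Submission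
  imports Defs
begin

text \<open>
  The first column identifies \<open>P\<close> with the slice \<open>{y. 0 \<le> y \<le> u, \<Sum>y = v\<^sub>1}\<close> of a box, whose interior
  meets the hyperplane; this gives \<open>d = p - 1\<close>. An entry \<open>(i, j)\<close> defines a facet of its own if
  \<open>u\<^sub>i\<close> is smaller than the other column sum, so \<open>n - d \<ge> p + 1 - a - b\<close>, where \<open>a\<close> and \<open>b\<close> count the rows
  with \<open>u\<^sub>i \<ge> v\<^sub>2\<close> and \<open>u\<^sub>i \<ge> v\<^sub>1\<close>.

  Let \<open>f\<close> be the number of coordinates that are not fixed on the smallest face containing two given
  vertices. Pivots that move one coordinate to its final bound lead from one vertex to the other in
  \<open>f - 1\<close> steps, unless both vertices are fractional at the same coordinate \<open>t\<close>; then one extra pivot,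
  which removes the fractional value at \<open>t\<close>, may be needed. At a vertex at most one row with
  \<open>u\<^sub>i \<ge> v\<^sub>1\<close> has a nonzero entry in the first column (similarly for the second), so at most two such rows
  count in \<open>f\<close>, and only \<open>t\<close> itself does in the exceptional case. This is exactly the saving \<open>a + b\<close>.
\<close>

subsection \<open>Pivoting between the vertices of a slice of a box\<close>

definition fractional :: "('a \<Rightarrow> real) \<Rightarrow> ('a \<Rightarrow> real) \<Rightarrow> 'a set" where
  "fractional u x = {i. 0 < x i \<and> x i < u i}"

text \<open>A point of the slice \<open>{0 \<le> x \<le> u, \<Sum>x = s}\<close> is a vertex iff at most one coordinate is fractional.
  The level \<open>s\<close> is left out because \<open>slice_adj\<close> preserves it.\<close>

definition slice_vertex :: "('a \<Rightarrow> real) \<Rightarrow> ('a \<Rightarrow> real) \<Rightarrow> bool" where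
  "slice_vertex u x \<longleftrightarrow> (\<forall>i. 0 \<le> x i \<and> x i \<le> u i) \<and> (\<forall>i\<in>fractional u x. \<forall>k\<in>fractional u x. i = k)"

text \<open>Symmetric in \<open>x\<close> and \<open>y\<close> in spite of its form: a coordinate
  that is fractional in only one of them is also one at which they differ.\<close>

definition free_coords :: "('a \<Rightarrow> real) \<Rightarrow> ('a \<Rightarrow> real) \<Rightarrow> ('a \<Rightarrow> real) \<Rightarrow> 'a set" where
  "free_coords u x y = {i. x i \<noteq> y i} \<union> fractional u x"

text \<open>The smallest face containing the vertices \<open>x\<close> and \<open>y\<close> fixes exactly the coordinates outside
  \<open>free_coords u x y\<close> and has dimension one less than their number; hence it is an edge iff there
  are two of them.\<close>

definition slice_adj :: "('a::finite \<Rightarrow> real) \<Rightarrow> (('a \<Rightarrow> real) \<times> ('a \<Rightarrow> real)) set" where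
  "slice_adj u = {(x, y). slice_vertex u x \<and> slice_vertex u y \<and> sum x UNIV = sum y UNIV \<and>
     x \<noteq> y \<and> (\<exists>i k. free_coords u x y \<subseteq> {i, k})}"

text \<open>A pivot at \<open>x\<close> involves its fractional coordinate \<open>t\<close>. If \<open>t\<close> is fractional in \<open>y\<close> as well, the
  pivot gains a coordinate of \<open>y\<close> only if \<open>t\<close> can absorb a full change of another coordinate. The
  condition below is preserved by pivots and guarantees that this is possible up to the end.\<close>

definition unobstructed :: "('a \<Rightarrow> real) \<Rightarrow> ('a \<Rightarrow> real) \<Rightarrow> ('a \<Rightarrow> real) \<Rightarrow> bool" where
  "unobstructed u x y \<longleftrightarrow> (\<forall>t\<in>fractional u x \<inter> fractional u y.
     sum u ({i. x i < y i} - {t}) \<le> x t \<or> sum u ({i. y i < x i} - {t}) \<le> u t - x t)"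

section \<open>Vertices of the slice, the reflection of the box, and single pivots\<close>

lemma slice_vertex_bounds:
  assumes "slice_vertex u x"
  shows "0 \<le> x i" "x i \<le> u i"
  using assms by (auto simp: slice_vertex_def)

lemma slice_vertex_unique_fractional:
  "slice_vertex u x \<Longrightarrow> i \<in> fractional u x \<Longrightarrow> k \<in> fractional u x \<Longrightarrow> i = k"
  by (auto simp: slice_vertex_def)

lemma slice_vertex_not_fractional:
  assumes "slice_vertex u x" "i \<notin> fractional u x"
  shows "x i = 0 \<or> x i = u i"
  using slice_vertex_bounds[OF assms(1), of i] assms(2) by (auto simp: fractional_def)

text \<open>The reflection of the box exchanges the two columns of the polytope and turns increases
  into decreases, so a one-sided argument is carried out once and then reflected.\<close>

lemma fractional_reflect: "fractional u (\<lambda>i. u i - x i) = fractional u x"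
  by (auto simp: fractional_def)

lemma slice_vertex_reflect: "slice_vertex u (\<lambda>i. u i - x i) \<longleftrightarrow> slice_vertex u x"
  by (auto simp: slice_vertex_def fractional_reflect)

lemma free_coords_reflect: "free_coords u (\<lambda>i. u i - x i) (\<lambda>i. u i - y i) = free_coords u x y"
  by (auto simp: free_coords_def fractional_reflect)

lemma slice_adj_reflect:
  "(\<lambda>i. u i - x i, \<lambda>i. u i - y i) \<in> slice_adj u \<longleftrightarrow> (x, y) \<in> slice_adj u"
proof -
  have "(\<lambda>i. u i - x i) = (\<lambda>i. u i - y i) \<longleftrightarrow> x = y"
    by (auto simp: fun_eq_iff)
  then show ?thesis
    by (simp add: slice_adj_def slice_vertex_reflect free_coords_reflect sum_subtractf)
qed

lemma unobstructed_reflect: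
  "unobstructed u (\<lambda>i. u i - x i) (\<lambda>i. u i - y i) \<longleftrightarrow> unobstructed u x y"
  unfolding unobstructed_def fractional_reflect by auto

text \<open>Moves as much as possible from \<open>k\<close> to \<open>i\<close>. One of the two
  reaches its bound, so the result is again a vertex. Both were free already, so no coordinate
  becomes free, and one is lost if the bound reached is the value in \<open>y\<close>.\<close>

lemma pivot:
  fixes u :: "'a::finite \<Rightarrow> real"
  assumes x: "slice_vertex u x" and "i \<noteq> k" "i \<in> free_coords u x y" "k \<in> free_coords u x y"
    and "x i < u i" "0 < x k" and ins: "fractional u x \<subseteq> {i, k}"
  obtains z where "(x, z) \<in> slice_adj u" "\<And>j. j \<noteq> i \<Longrightarrow> j \<noteq> k \<Longrightarrow> z j = x j"
    "z i + z k = x i + x k" "x i < z i" "z k < x k" "fractional u z \<subseteq> {i, k}"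
    "z i = u i \<or> z k = 0" "free_coords u z y \<subseteq> free_coords u x y"
    "z i = u i \<Longrightarrow> y i = u i \<Longrightarrow> free_coords u z y \<subset> free_coords u x y"
    "z k = 0 \<Longrightarrow> y k = 0 \<Longrightarrow> free_coords u z y \<subset> free_coords u x y"
proof -
  define \<delta> where "\<delta> = min (u i - x i) (x k)"
  define z where "z = (\<lambda>j. x j + (if j = i then \<delta> else 0) - (if j = k then \<delta> else 0))"
  have \<delta>: "0 < \<delta>" "\<delta> \<le> u i - x i" "\<delta> \<le> x k" "\<delta> = u i - x i \<or> \<delta> = x k"
    using assms by (auto simp: \<delta>_def min_def)
  have zi: "z i = x i + \<delta>" and zk: "z k = x k - \<delta>"
    using \<open>i \<noteq> k\<close> by (auto simp: z_def)
  have zj: "z j = x j" if "j \<noteq> i" "j \<noteq> k" for j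
    using that by (simp add: z_def)
  have bd: "z i = u i \<or> z k = 0"
    using \<delta> zi zk by auto
  have insz: "fractional u z \<subseteq> {i, k}"
  proof
    fix j assume "j \<in> fractional u z"
    then show "j \<in> {i, k}"
      using ins zj[of j] by (auto simp: fractional_def)
  qed
  have "slice_vertex u z"
    unfolding slice_vertex_def
  proof (intro conjI allI ballI)
    fix j
    consider "j = i" | "j = k" | "j \<noteq> i" "j \<noteq> k" by blast
    then have "0 \<le> z j \<and> z j \<le> u j"
    proof cases
      case 1
      then show ?thesis
        using slice_vertex_bounds[OF x, of i] \<delta>(1,2) zi unfolding 1 by (intro conjI) linarith+
    next
      case 2
      then show ?thesis
        using slice_vertex_bounds[OF x, of k] \<delta>(1,3) zk unfolding 2 by (intro conjI) linarith+
    next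
      case 3
      then show ?thesis
        using slice_vertex_bounds[OF x, of j] zj[OF 3] by simp
    qed
    then show "0 \<le> z j" "z j \<le> u j" by blast+
  next
    fix j j' assume j: "j \<in> fractional u z" "j' \<in> fractional u z"
    have "i \<notin> fractional u z \<or> k \<notin> fractional u z"
      using bd by (auto simp: fractional_def)
    with j insz show "j = j'" by blast
  qed
  moreover have "sum z UNIV = sum x UNIV"
    by (simp add: z_def sum.distrib sum_subtractf)
  moreover have "free_coords u x z \<subseteq> {i, k}"
  proof
    fix j assume "j \<in> free_coords u x z"
    then show "j \<in> {i, k}"
      using ins zj[of j] by (cases "j = i"; cases "j = k") (auto simp: free_coords_def)
  qed
  moreover have "x \<noteq> z"
    using zi \<delta> by (auto dest: fun_cong)
  ultimately have adj: "(x, z) \<in> slice_adj u"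
    using x by (auto simp: slice_adj_def)
  have sub: "free_coords u z y \<subseteq> free_coords u x y"
  proof
    fix j assume j: "j \<in> free_coords u z y"
    show "j \<in> free_coords u x y"
    proof (cases "j = i \<or> j = k")
      case False
      then show ?thesis
        using j insz zj[of j] by (auto simp: free_coords_def)
    qed (use assms(3,4) in auto)
  qed
  show ?thesis
  proof (rule that[OF adj])
    show "free_coords u z y \<subset> free_coords u x y" if "z i = u i" "y i = u i"
    proof -
      have "i \<notin> free_coords u z y"
        using that by (simp add: free_coords_def fractional_def)
      then show ?thesis using sub assms(3) by blast
    qed
    show "free_coords u z y \<subset> free_coords u x y" if "z k = 0" "y k = 0"
    proof -
      have "k \<notin> free_coords u z y"
        using that by (simp add: free_coords_def fractional_def)
      then show ?thesis using sub assms(4) by blast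
    qed
    show "z i + z k = x i + x k" "x i < z i" "z k < x k"
      using zi zk \<delta> by auto
  qed (use zj bd insz sub in blast)+
qed

text \<open>The shared coordinate \<open>t\<close> pays for raising \<open>i\<close>. Either it can
  pay all of \<open>u i\<close>, and \<open>i\<close> reaches its final value, or it drops to 0 and
  is no longer fractional, which makes \<open>unobstructed\<close> hold trivially.\<close>

lemma step_down:
  fixes u :: "'a::finite \<Rightarrow> real"
  assumes x: "slice_vertex u x" and y: "slice_vertex u y"
    and t: "t \<in> fractional u x" "t \<in> fractional u y"
    and i: "x i < y i" "i \<noteq> t"
  obtains z where "(x, z) \<in> slice_adj u" "free_coords u z y \<subseteq> free_coords u x y"
    "u i \<le> x t \<Longrightarrow> free_coords u z y \<subset> free_coords u x y"
    "sum u ({i. x i < y i} - {t}) \<le> x t \<Longrightarrow> unobstructed u z y"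
    "x t < u i \<Longrightarrow> unobstructed u z y"
proof -
  have xi: "x i = 0" and yi: "y i = u i"
    using slice_vertex_not_fractional[OF x, of i] slice_vertex_not_fractional[OF y, of i]
      slice_vertex_unique_fractional[OF x t(1), of i] slice_vertex_unique_fractional[OF y t(2), of i]
      slice_vertex_bounds[OF x, of i] slice_vertex_bounds[OF y, of i] i by auto
  have insx: "fractional u x = {t}" and insy: "fractional u y = {t}"
    using t slice_vertex_unique_fractional[OF x] slice_vertex_unique_fractional[OF y] by auto
  obtain z where z: "(x, z) \<in> slice_adj u" "\<And>j. j \<noteq> i \<Longrightarrow> j \<noteq> t \<Longrightarrow> z j = x j"
    "z i + z t = x i + x t" "x i < z i" "z t < x t" "fractional u z \<subseteq> {i, t}"
    "z i = u i \<or> z t = 0" "free_coords u z y \<subseteq> free_coords u x y"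
    "z i = u i \<Longrightarrow> y i = u i \<Longrightarrow> free_coords u z y \<subset> free_coords u x y"
    by (rule pivot[OF x i(2), of y])
      (use t i yi xi insx in \<open>auto simp: free_coords_def fractional_def\<close>)
  have vz: "slice_vertex u z"
    using z(1) by (simp add: slice_adj_def)
  have zi: "z i = u i" if "u i \<le> x t"
    using z(3,7) that xi slice_vertex_bounds[OF vz, of i] by auto
  show ?thesis
  proof (rule that[OF z(1) z(8)])
    show "free_coords u z y \<subset> free_coords u x y" if "u i \<le> x t"
      using z(9) zi yi that by simp
    show "unobstructed u z y" if le: "sum u ({i. x i < y i} - {t}) \<le> x t"
    proof -
      \<comment> \<open>The demand of the remaining increases and the supply at \<open>t\<close>
        both drop by \<open>u i\<close>, so the inequality survives the pivot.\<close>
      let ?U = "{i. x i < y i} - {t}"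
      have split: "sum u ?U = u i + sum u (?U - {i})"
        using i by (intro sum.remove) auto
      have "0 \<le> sum u (?U - {i})"
        using slice_vertex_bounds[OF x] by (intro sum_nonneg) (meson order_trans)
      then have "u i \<le> x t" using split le by linarith
      then have zi: "z i = u i" by (rule zi)
      have "{i. z i < y i} - {t} = ?U - {i}"
      proof (rule set_eqI)
        fix j show "j \<in> {i. z i < y i} - {t} \<longleftrightarrow> j \<in> ?U - {i}"
          using z(2)[of j] zi yi by (cases "j = i"; cases "j = t") auto
      qed
      then have "sum u ({i. z i < y i} - {t}) \<le> z t"
        using split le z(3) zi xi by simp
      then show ?thesis
        using insy by (simp add: unobstructed_def)
    qed
    show "unobstructed u z y" if "x t < u i"
    proof -
      have "z t = 0"
        using z(3,7) that xi slice_vertex_bounds[OF vz, of t] by auto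
      then show ?thesis
        using insy by (auto simp: unobstructed_def fractional_def)
    qed
  qed
qed

section \<open>Pivots that remove a free coordinate\<close>

lemma exists_less_if_sum_eq:
  fixes x y :: "'a::finite \<Rightarrow> real"
  assumes "sum x UNIV = sum y UNIV" "x \<noteq> y"
  shows "\<exists>i. x i < y i"
proof (rule ccontr)
  assume "\<not> ?thesis"
  then have ge: "\<And>i. y i \<le> x i" by (simp add: not_less)
  obtain i where "y i < x i"
    using assms(2) ge by (metis ext order_less_le)
  then have "sum y UNIV < sum x UNIV"
    by (intro sum_strict_mono_ex1) (use ge in auto)
  with assms(1) show False by simp
qed

definition improves :: "('a::finite \<Rightarrow> real) \<Rightarrow> ('a \<Rightarrow> real) \<Rightarrow> ('a \<Rightarrow> real) \<Rightarrow> bool" where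
  "improves u x y \<longleftrightarrow> (\<exists>z. (x, z) \<in> slice_adj u \<and> free_coords u z y \<subset> free_coords u x y \<and> unobstructed u z y)"

lemma improves_reflect:
  assumes "improves u (\<lambda>i. u i - x i) (\<lambda>i. u i - y i)"
  shows "improves u x y"
proof -
  obtain z where z: "(\<lambda>i. u i - x i, z) \<in> slice_adj u"
    "free_coords u z (\<lambda>i. u i - y i) \<subset> free_coords u (\<lambda>i. u i - x i) (\<lambda>i. u i - y i)"
    "unobstructed u z (\<lambda>i. u i - y i)"
    using assms by (auto simp: improves_def)
  define w where "w = (\<lambda>i. u i - z i)"
  have "z = (\<lambda>i. u i - w i)" by (auto simp: w_def)
  with z show ?thesis
    by (auto simp: improves_def slice_adj_reflect free_coords_reflect unobstructed_reflect)
qed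

lemma improves_if_common_fractional:
  fixes u :: "'a::finite \<Rightarrow> real"
  assumes "slice_vertex u x" "slice_vertex u y"
    and "t \<in> fractional u x" "t \<in> fractional u y" "x i < y i" "i \<noteq> t"
    and "sum u ({i. x i < y i} - {t}) \<le> x t"
  shows "improves u x y"
proof -
  have "u i \<le> sum u ({i. x i < y i} - {t})"
    using assms slice_vertex_bounds[OF assms(1)]
    by (intro member_le_sum) (auto intro: order_trans)
  then show ?thesis
    using step_down[OF assms(1-6)] assms(7) unfolding improves_def by (metis order_trans)
qed

text \<open>If the only coordinate that has to increase is the one at which \<open>y\<close> is fractional, that
  coordinate absorbs all of the decreases one after the other.\<close>

lemma improves_if_single_increase:
  fixes u :: "'a::finite \<Rightarrow> real"
  assumes x: "slice_vertex u x" and y: "slice_vertex u y" and eq: "sum x UNIV = sum y UNIV"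
    and U: "{i. x i < y i} = {s}" and s: "s \<in> fractional u y" "s \<notin> fractional u x"
    and k: "y k < x k" and ins: "fractional u x \<subseteq> {k}"
  shows "improves u x y"
proof -
  have xs: "x s < y s" using U by auto
  have xs0: "x s = 0"
    using slice_vertex_not_fractional[OF x s(2)] xs slice_vertex_bounds[OF y, of s] by auto
  have ks: "k \<noteq> s" using k xs by auto
  have "k \<notin> fractional u y"
    using slice_vertex_unique_fractional[OF y s(1)] ks by auto
  then have yk: "y k = 0"
    using slice_vertex_not_fractional[OF y] k slice_vertex_bounds[OF x, of k] by fastforce
  obtain z where z: "(x, z) \<in> slice_adj u" "\<And>j. j \<noteq> s \<Longrightarrow> j \<noteq> k \<Longrightarrow> z j = x j"
    "z s + z k = x s + x k" "x s < z s" "z k < x k" "fractional u z \<subseteq> {s, k}"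
    "z s = u s \<or> z k = 0" "free_coords u z y \<subseteq> free_coords u x y"
    "z k = 0 \<Longrightarrow> y k = 0 \<Longrightarrow> free_coords u z y \<subset> free_coords u x y"
    by (rule pivot[OF x, of s k y])
      (use s k xs ks yk ins slice_vertex_bounds[OF y, of s] in \<open>auto simp: free_coords_def fractional_def\<close>)
  have vz: "slice_vertex u z"
    using z(1) by (simp add: slice_adj_def)
  \<comment> \<open>\<open>s\<close> starts at 0 and is the only coordinate that rises, so
    \<open>y s\<close> is the sum of all decreases, among them \<open>x k\<close>.\<close>
  have "x k \<le> y s"
  proof -
    have "(\<Sum>j\<in>UNIV - {s}. x j - y j) = y s - x s"
      using eq by (simp add: sum_subtractf sum_diff1)
    moreover have "x k - y k \<le> (\<Sum>j\<in>UNIV - {s}. x j - y j)"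
      using ks U by (intro member_le_sum) (auto simp: not_less[symmetric])
    ultimately show ?thesis using yk xs0 by simp
  qed
  then have "x k < u s" using s(1) by (auto simp: fractional_def)
  then have zk: "z k = 0"
    using z(3,7) xs0 slice_vertex_bounds[OF vz, of k] by auto
  have "unobstructed u z y"
    unfolding unobstructed_def
  proof (intro ballI disjI1)
    fix t assume t: "t \<in> fractional u z \<inter> fractional u y"
    then have ts: "t = s" using slice_vertex_unique_fractional[OF y s(1)] by auto
    have "{i. z i < y i} - {t} = {}"
      using U z(2) zk yk ts by (auto, metis mem_Collect_eq order_less_irrefl singletonD)
    then show "sum u ({i. z i < y i} - {t}) \<le> z t"
      using slice_vertex_bounds[OF vz] by (metis sum.empty)
  qed
  then show ?thesis
    using z zk yk by (auto simp: improves_def)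
qed

text \<open>In \<open>y\<close> both coordinates lie at the bounds towards which the pivot moves
  them, so whichever bound is reached first is final. A fractional coordinate of the result is one
  of the two and thus not shared with \<open>y\<close>.\<close>

lemma improves_if_disjoint_pair:
  fixes u :: "'a::finite \<Rightarrow> real"
  assumes x: "slice_vertex u x" and y: "slice_vertex u y"
    and ik: "x i < y i" "y k < x k" and ins: "fractional u x \<subseteq> {i, k}"
    and dis: "i \<notin> fractional u y" "k \<notin> fractional u y"
  shows "improves u x y"
proof -
  have yi: "y i = u i"
    using slice_vertex_not_fractional[OF y dis(1)] ik slice_vertex_bounds[OF x, of i] by auto
  have yk: "y k = 0"
    using slice_vertex_not_fractional[OF y dis(2)] ik slice_vertex_bounds[OF x, of k] by auto
  obtain z where z: "(x, z) \<in> slice_adj u" "fractional u z \<subseteq> {i, k}"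
    "z i = u i \<or> z k = 0"
    "z i = u i \<Longrightarrow> y i = u i \<Longrightarrow> free_coords u z y \<subset> free_coords u x y"
    "z k = 0 \<Longrightarrow> y k = 0 \<Longrightarrow> free_coords u z y \<subset> free_coords u x y"
    by (rule pivot[OF x, of i k y]) (use ik yi yk ins in \<open>auto simp: free_coords_def fractional_def\<close>)
  have "unobstructed u z y"
    using z(2) dis by (auto simp: unobstructed_def)
  then show ?thesis
    using z yi yk by (auto simp: improves_def)
qed

text \<open>If some rising coordinate is not fractional in \<open>y\<close>, it forms a disjoint
  pair with \<open>k\<close>; otherwise the only rising one is the fractional coordinate of
  \<open>y\<close>.\<close>

lemma improves_if_decrease_fractional:
  fixes u :: "'a::finite \<Rightarrow> real"
  assumes x: "slice_vertex u x" and y: "slice_vertex u y" and eq: "sum x UNIV = sum y UNIV"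
    and k: "y k < x k" "k \<notin> fractional u y" and ins: "fractional u x \<subseteq> {k}"
  shows "improves u x y"
proof -
  have "x \<noteq> y" using k by auto
  then obtain i where i: "x i < y i"
    using exists_less_if_sum_eq[OF eq] by auto
  show ?thesis
  proof (cases "\<exists>i. x i < y i \<and> i \<notin> fractional u y")
    case True
    then show ?thesis
      using improves_if_disjoint_pair[OF x y _ k(1) _ _ k(2)] ins by blast
  next
    case False
    then have "i \<in> fractional u y" using i by auto
    then have "{i. x i < y i} = {i}"
      using i False slice_vertex_unique_fractional[OF y] by auto
    moreover have "i \<notin> fractional u x" using ins i k by auto
    ultimately show ?thesis
      using improves_if_single_increase[OF x y eq _ \<open>i \<in> fractional u y\<close> _ k(1) ins] by auto
  qed
qed

lemma improves_if_increase_fractional: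
  fixes u :: "'a::finite \<Rightarrow> real"
  assumes "slice_vertex u x" "slice_vertex u y" "sum x UNIV = sum y UNIV"
    and "x i < y i" "i \<notin> fractional u y" "fractional u x \<subseteq> {i}"
  shows "improves u x y"
  by (rule improves_reflect, rule improves_if_decrease_fractional[where k = i])
    (use assms in \<open>auto simp: slice_vertex_reflect fractional_reflect sum_subtractf\<close>)

text \<open>If no fractional coordinate is shared, that of \<open>x\<close> has a bound as its final
  value and can be pivoted; if \<open>x\<close> has none, a rising or a falling coordinate takes
  this role.\<close>

lemma unobstructed_improves:
  fixes u :: "'a::finite \<Rightarrow> real"
  assumes x: "slice_vertex u x" and y: "slice_vertex u y" and eq: "sum x UNIV = sum y UNIV"
    and "x \<noteq> y" and un: "unobstructed u x y"
  shows "improves u x y"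
proof (cases "fractional u x \<inter> fractional u y = {}")
  case True
  obtain i where i: "x i < y i" using exists_less_if_sum_eq[OF eq \<open>x \<noteq> y\<close>] by auto
  obtain k where k: "y k < x k" using exists_less_if_sum_eq[OF eq[symmetric]] \<open>x \<noteq> y\<close> by auto
  have ik: "i \<noteq> k" using i k by auto
  show ?thesis
  proof (cases "fractional u x = {}")
    case True
    have "i \<notin> fractional u y \<or> k \<notin> fractional u y"
      using slice_vertex_unique_fractional[OF y] ik by blast
    then show ?thesis
      using improves_if_decrease_fractional[OF x y eq k] improves_if_increase_fractional[OF x y eq i] True
      by auto
  next
    case False
    then obtain t where t: "fractional u x = {t}"
      using slice_vertex_unique_fractional[OF x] by blast
    then have "t \<notin> fractional u y" using True by auto
    then have "x t \<noteq> y t" using t by (auto simp: fractional_def)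
    then consider "x t < y t" | "y t < x t" by linarith
    then show ?thesis
      using improves_if_decrease_fractional[OF x y eq, of t] improves_if_increase_fractional[OF x y eq, of t] t
        \<open>t \<notin> fractional u y\<close> by cases auto
  qed
next
  case False
  then obtain t where t: "t \<in> fractional u x" "t \<in> fractional u y" by auto
  have tt: "0 < u t - x t" "0 < x t" using t by (auto simp: fractional_def)
  let ?U = "{i. x i < y i} - {t}" and ?D = "{i. y i < x i} - {t}"
  have up: ?thesis if "?U \<noteq> {}" "sum u ?U \<le> x t"
    using that improves_if_common_fractional[OF x y t] by auto
  have down: ?thesis if "?D \<noteq> {}" "sum u ?D \<le> u t - x t"
  proof -
    from that obtain i where "y i < x i" "i \<noteq> t" by auto
    then have "improves u (\<lambda>i. u i - x i) (\<lambda>i. u i - y i)"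
      using that(2) x y t
      by (intro improves_if_common_fractional[of _ _ _ t i])
        (auto simp: slice_vertex_reflect fractional_reflect)
    then show ?thesis by (rule improves_reflect)
  qed
  have bal: "(\<Sum>j\<in>UNIV - {t}. x j - y j) = y t - x t"
    using eq by (simp add: sum_subtractf sum_diff1)
  have val: "x j - y j = (if j \<in> ?D then u j else 0) - (if j \<in> ?U then u j else 0)" if "j \<noteq> t" for j
  proof -
    have "j \<notin> fractional u x" "j \<notin> fractional u y"
      using that t slice_vertex_unique_fractional[OF x] slice_vertex_unique_fractional[OF y] by blast+
    then show ?thesis
      using slice_vertex_not_fractional[OF x, of j] slice_vertex_not_fractional[OF y, of j] that
        slice_vertex_bounds[OF x, of j] by auto
  qed
  have restrict: "(\<Sum>j\<in>UNIV - {t}. if j \<in> B - {t} then u j else 0) = sum u (B - {t})" for B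
    by (rule sum.mono_neutral_cong_right) auto
  have "(\<Sum>j\<in>UNIV - {t}. x j - y j)
      = (\<Sum>j\<in>UNIV - {t}. (if j \<in> ?D then u j else 0) - (if j \<in> ?U then u j else 0))"
    using val by (intro sum.cong) auto
  also have "\<dots> = sum u ?D - sum u ?U"
    by (simp only: sum_subtractf restrict)
  finally have diff: "sum u ?D - sum u ?U = y t - x t" using bal by simp
  have yt: "0 < y t" "y t < u t" using t by (auto simp: fractional_def)
  \<comment> \<open>If the side that \<open>unobstructed\<close> provides has nothing to move, the
    total of the other side is the change at \<open>t\<close>. As \<open>y t\<close> is strictly
    between 0 and \<open>u t\<close>, that side fits too, so cases 4 and 5 are
    contradictory.\<close>
  consider "?U \<noteq> {}" "sum u ?U \<le> x t" | "?D \<noteq> {}" "sum u ?D \<le> u t - x t"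
    | "?U = {}" "?D = {}"
    | "?U = {}" "?D \<noteq> {}" "\<not> sum u ?D \<le> u t - x t"
    | "?D = {}" "?U \<noteq> {}" "\<not> sum u ?U \<le> x t"
    using un t unfolding unobstructed_def by blast
  then show ?thesis
  proof cases
    case 3
    then have "x t = y t" using diff by (metis diff_self eq_iff_diff_eq_0)
    moreover have "x j = y j" if "j \<noteq> t" for j
      using val[OF that] 3 by auto
    ultimately have "x = y" by (metis ext)
    with \<open>x \<noteq> y\<close> show ?thesis by simp
  next
    case 4
    then have "sum u ?U = 0" by (metis sum.empty)
    with 4 diff yt show ?thesis by linarith
  next
    case 5
    then have "sum u ?D = 0" by (metis sum.empty)
    with 5 diff yt show ?thesis by linarith
  qed (use up down in auto)
qed

section \<open>Lengths of walks in the slice\<close>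

lemma card_free_coords_ge_2:
  fixes u :: "'a::finite \<Rightarrow> real"
  assumes "sum x UNIV = sum y UNIV" "x \<noteq> y"
  shows "2 \<le> card (free_coords u x y)"
proof -
  obtain i where i: "x i < y i" using exists_less_if_sum_eq assms by blast
  obtain k where k: "y k < x k" using exists_less_if_sum_eq assms by metis
  have "card {i, k} \<le> card (free_coords u x y)"
    by (rule card_mono) (use i k in \<open>auto simp: free_coords_def\<close>)
  moreover have "i \<noteq> k" using i k by auto
  ultimately show ?thesis by simp
qed

text \<open>Each step removes a free coordinate, and before the last step at least two are left;
  hence one step fewer than there are free coordinates.\<close>

lemma unobstructed_distance:
  fixes u :: "'a::finite \<Rightarrow> real"
  assumes "slice_vertex u x" "slice_vertex u y" "sum x UNIV = sum y UNIV" "unobstructed u x y"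
  shows "\<exists>m \<le> card (free_coords u x y) - 1. (x, y) \<in> slice_adj u ^^ m"
  using assms
proof (induction "card (free_coords u x y)" arbitrary: x rule: less_induct)
  case less
  show ?case
  proof (cases "x = y")
    case True
    then show ?thesis by (intro exI[of _ 0]) auto
  next
    case False
    then obtain z where z: "(x, z) \<in> slice_adj u" "free_coords u z y \<subset> free_coords u x y" "unobstructed u z y"
      using unobstructed_improves[OF less.prems(1-3) False less.prems(4)]
      by (auto simp: improves_def)
    have lt: "card (free_coords u z y) < card (free_coords u x y)"
      using z(2) by (intro psubset_card_mono) auto
    have "slice_vertex u z" "sum z UNIV = sum y UNIV"
      using z(1) less.prems(3) by (auto simp: slice_adj_def)
    then obtain m where "m \<le> card (free_coords u z y) - 1" "(z, y) \<in> slice_adj u ^^ m"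
      using less.hyps[OF lt] less.prems(2) z(3) by auto
    \<comment> \<open>The lower bound 2 matters if \<open>card (free_coords u z y)\<close> is 0,
      where the subtraction of 1 is truncated.\<close>
    then have "(x, y) \<in> slice_adj u ^^ Suc m" "Suc m \<le> card (free_coords u x y) - 1"
      using z(1) lt card_free_coords_ge_2[OF less.prems(3) False, of u] relpow_Suc_I2 by fastforce+
    then show ?thesis by blast
  qed
qed

text \<open>An obstructed pivot at the shared \<open>t\<close> either removes a free coordinate or
  empties \<open>t\<close>. The latter happens at most once, since the rest of the walk is
  unobstructed; it costs the one extra step.\<close>

lemma slice_distance:
  fixes u :: "'a::finite \<Rightarrow> real"
  assumes "slice_vertex u x" "slice_vertex u y" "sum x UNIV = sum y UNIV"
  shows "\<exists>m \<le> card (free_coords u x y). (x, y) \<in> slice_adj u ^^ m"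
  using assms
proof (induction "card (free_coords u x y)" arbitrary: x rule: less_induct)
  case less
  show ?case
  proof (cases "unobstructed u x y")
    case True
    then show ?thesis
      using unobstructed_distance[OF less.prems] by (meson diff_le_self order_trans)
  next
    case False
    then obtain t where t: "t \<in> fractional u x" "t \<in> fractional u y"
      and gt: "x t < sum u ({i. x i < y i} - {t})"
      by (auto simp: unobstructed_def)
    have "{i. x i < y i} - {t} \<noteq> {}"
      using gt t(1) by (metis fractional_def mem_Collect_eq order_less_asym sum.empty)
    then obtain i where i: "x i < y i" "i \<noteq> t" by auto
    obtain z where z: "(x, z) \<in> slice_adj u" "free_coords u z y \<subseteq> free_coords u x y"
      "u i \<le> x t \<Longrightarrow> free_coords u z y \<subset> free_coords u x y" "x t < u i \<Longrightarrow> unobstructed u z y"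
      using step_down[OF less.prems(1,2) t i] by metis
    have vz: "slice_vertex u z" "sum z UNIV = sum y UNIV"
      using z(1) less.prems(3) by (auto simp: slice_adj_def)
    have le: "card (free_coords u z y) \<le> card (free_coords u x y)"
      using z(2) by (intro card_mono) auto
    have pos: "0 < card (free_coords u x y)"
      using t by (auto simp: card_gt_0_iff free_coords_def)
    have "\<exists>m < card (free_coords u x y). (z, y) \<in> slice_adj u ^^ m"
    proof (cases "u i \<le> x t")
      case True
      then have lt: "card (free_coords u z y) < card (free_coords u x y)"
        using z(3) by (intro psubset_card_mono) auto
      then show ?thesis
        using less.hyps[OF lt vz(1) less.prems(2) vz(2)] by (meson le_less_trans)
    next
      case False
      then obtain m where "m \<le> card (free_coords u z y) - 1" "(z, y) \<in> slice_adj u ^^ m"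
        using unobstructed_distance[OF vz(1) less.prems(2) vz(2)] z(4) by auto
      then show ?thesis using le pos by (intro exI[of _ m]) auto
    qed
    then obtain m where "m < card (free_coords u x y)" "(z, y) \<in> slice_adj u ^^ m" by auto
    then show ?thesis
      using relpow_Suc_I2[OF z(1)] by (intro exI[of _ "Suc m"]) auto
  qed
qed


section \<open>Rows whose total reaches a column sum\<close>

lemma vertex_full_entry:
  fixes u :: "'a::finite \<Rightarrow> real"
  assumes "slice_vertex u x" "x i = u i" "sum x UNIV \<le> u i" "x j \<noteq> 0"
  shows "i = j"
proof (rule ccontr)
  assume ne: "i \<noteq> j"
  have nn: "\<And>l. 0 \<le> x l" using slice_vertex_bounds[OF assms(1)] by simp
  have "sum x {i, j} \<le> sum x UNIV"
    by (intro sum_mono2) (use nn in auto)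
  then show False
    using ne assms nn[of j] by simp
qed

text \<open>Of two distinct nonzero entries one is not fractional, hence full, and already exhausts
  the sum.\<close>

lemma vertex_large_entry_unique:
  fixes u :: "'a::finite \<Rightarrow> real"
  assumes "slice_vertex u x" "sum x UNIV \<le> u i" "sum x UNIV \<le> u j" "x i \<noteq> 0" "x j \<noteq> 0"
  shows "i = j"
proof (cases "i \<in> fractional u x \<and> j \<in> fractional u x")
  case True
  then show ?thesis using slice_vertex_unique_fractional[OF assms(1)] by blast
next
  case False
  then have "x i = u i \<or> x j = u j"
    using slice_vertex_not_fractional[OF assms(1)] assms(4,5) by blast
  then show ?thesis
    using vertex_full_entry[OF assms(1) _ assms(2,5)] vertex_full_entry[OF assms(1) _ assms(3,4)]
    by blast
qed

lemma card_free_large: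
  fixes u :: "'a::finite \<Rightarrow> real"
  assumes "slice_vertex u x" "slice_vertex u y" "sum x UNIV = s" "sum y UNIV = s"
  shows "card (free_coords u x y \<inter> {i. s \<le> u i}) \<le> 2"
proof -
  let ?N = "\<lambda>x. {i. s \<le> u i \<and> x i \<noteq> (0::real)}"
  have "card (?N z) \<le> 1" if "slice_vertex u z" "sum z UNIV = s" for z
    using vertex_large_entry_unique[OF that(1)] that(2) by (auto simp: card_le_Suc0_iff_eq)
  then have "card (?N x) + card (?N y) \<le> 2"
    using assms add_le_mono[of "card (?N x)" 1 "card (?N y)" 1] by simp
  moreover have "free_coords u x y \<inter> {i. s \<le> u i} \<subseteq> ?N x \<union> ?N y"
    by (auto simp: free_coords_def fractional_def)
  then have "card (free_coords u x y \<inter> {i. s \<le> u i}) \<le> card (?N x \<union> ?N y)"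
    by (intro card_mono) auto
  ultimately show ?thesis
    using card_Un_le[of "?N x" "?N y"] by linarith
qed

text \<open>Any other such \<open>i\<close> changes between its two bounds and is full in one
  vertex, which leaves nothing for \<open>t\<close> there.\<close>

lemma large_free_entry_common_fractional:
  fixes u :: "'a::finite \<Rightarrow> real"
  assumes x: "slice_vertex u x" and y: "slice_vertex u y"
    and s: "sum x UNIV = s" "sum y UNIV = s"
    and t: "t \<in> fractional u x" "t \<in> fractional u y" and i: "i \<in> free_coords u x y" "s \<le> u i"
  shows "i = t"
proof (rule ccontr)
  assume "i \<noteq> t"
  then have ni: "i \<notin> fractional u x" "i \<notin> fractional u y"
    using t slice_vertex_unique_fractional[OF x] slice_vertex_unique_fractional[OF y] by blast+
  then have "x i \<noteq> y i" using i by (auto simp: free_coords_def)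
  then have "x i = u i \<or> y i = u i"
    using slice_vertex_not_fractional[OF x ni(1)] slice_vertex_not_fractional[OF y ni(2)] by auto
  moreover have "x t \<noteq> 0" "y t \<noteq> 0" using t by (auto simp: fractional_def)
  ultimately show False
    using vertex_full_entry[OF x, of i t] vertex_full_entry[OF y, of i t] s i \<open>i \<noteq> t\<close> by auto
qed

text \<open>\<open>s\<close> and \<open>s'\<close> are the two column sums. The last hypothesis
  leaves two cases: one of the two sets counted is empty, or both consist of the same row.\<close>

lemma slice_diameter:
  fixes u :: "'a::finite \<Rightarrow> real"
  assumes x: "slice_vertex u x" and y: "slice_vertex u y"
    and s: "sum x UNIV = s" "sum y UNIV = s" and s': "sum u UNIV = s + s'"
    and AB: "\<And>i j. s' \<le> u i \<Longrightarrow> s \<le> u j \<Longrightarrow> i = j"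
  shows "\<exists>m. m + card {i. s' \<le> u i} + card {i. s \<le> u i} \<le> CARD('a) + 1 \<and> (x, y) \<in> slice_adj u ^^ m"
proof -
  let ?A = "{i. s' \<le> u i}" and ?B = "{i. s \<le> u i}" and ?F = "free_coords u x y"
  have eq: "sum x UNIV = sum y UNIV" using s by simp
  let ?x = "\<lambda>i. u i - x i" and ?y = "\<lambda>i. u i - y i"
  have refl: "slice_vertex u ?x" "slice_vertex u ?y" "sum ?x UNIV = s'" "sum ?y UNIV = s'"
    using x y s s' by (auto simp: slice_vertex_reflect sum_subtractf)
  have FA: "card (?F \<inter> ?A) \<le> 2"
    using card_free_large[OF refl] by (simp add: free_coords_reflect)
  have FB: "card (?F \<inter> ?B) \<le> 2"
    using card_free_large[OF x y s] by simp
  have common: "?F \<inter> (?A \<union> ?B) \<subseteq> {t}" if t: "t \<in> fractional u x" "t \<in> fractional u y" for t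
    using large_free_entry_common_fractional[OF x y s t]
      large_free_entry_common_fractional[OF refl, of t] t by (auto simp: free_coords_reflect fractional_reflect)
  have cardF: "card ?F + card C \<le> CARD('a) + card (?F \<inter> C)" for C
  proof -
    have "card (?F \<union> C) \<le> CARD('a)" by (intro card_mono) auto
    then show ?thesis using card_Un_Int[of ?F C] by auto
  qed
  show ?thesis
  proof (cases "?A = {} \<or> ?B = {}")
    case True
    then have C: "card ?A + card ?B = card (?A \<union> ?B)"
      by (elim disjE) (simp_all only: card.empty Un_empty_left Un_empty_right add_0 add_0_right)
    have "card (?F \<inter> (?A \<union> ?B)) \<le> 2"
      using True FA FB by (elim disjE) (simp_all only: Un_empty_left Un_empty_right)
    show ?thesis
    proof (cases "unobstructed u x y")
      case True
      then obtain m where m: "m \<le> card ?F - 1" "(x, y) \<in> slice_adj u ^^ m"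
        using unobstructed_distance[OF x y eq] by auto
      \<comment> \<open>Covers \<open>card ?F = 0\<close>, where \<open>card ?F - 1\<close> is
        truncated.\<close>
      have "card (?A \<union> ?B) \<le> CARD('a)" by (intro card_mono) auto
      then have "m + card (?A \<union> ?B) \<le> CARD('a) + 1"
        using m(1) cardF[of "?A \<union> ?B"] \<open>card (?F \<inter> (?A \<union> ?B)) \<le> 2\<close> by linarith
      then show ?thesis using m(2) C by (intro exI[of _ m]) linarith
    next
      case False
      then obtain t where t: "t \<in> fractional u x" "t \<in> fractional u y"
        by (auto simp: unobstructed_def)
      obtain m where m: "m \<le> card ?F" "(x, y) \<in> slice_adj u ^^ m"
        using slice_distance[OF x y eq] by auto
      \<comment> \<open>This pays for the extra step: only \<open>t\<close> can be a large row that
        is free.\<close>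
      have "card (?F \<inter> (?A \<union> ?B)) \<le> 1"
        using card_mono[OF _ common[OF t]] by simp
      then have "m + card (?A \<union> ?B) \<le> CARD('a) + 1"
        using m(1) cardF[of "?A \<union> ?B"] by linarith
      then show ?thesis using m(2) C by (intro exI[of _ m]) linarith
    qed
  next
    case False
    then obtain i j where ij: "s' \<le> u i" "s \<le> u j" by auto
    have A: "?A = {i}" and B: "?B = {i}"
      using AB ij by blast+
    \<comment> \<open>Both sets contain exactly \<open>i\<close>, so \<open>CARD('a) + 1 - 2\<close>
      steps are allowed.\<close>
    have "\<exists>m \<le> CARD('a) - 1. (x, y) \<in> slice_adj u ^^ m"
    proof (cases "unobstructed u x y")
      case True
      obtain m where m: "m \<le> card ?F - 1" "(x, y) \<in> slice_adj u ^^ m"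
        using unobstructed_distance[OF x y eq True] by blast
      have "card ?F \<le> CARD('a)" by (intro card_mono) auto
      with m show ?thesis by (intro exI[of _ m]) auto
    next
      case False
      then obtain t where t: "t \<in> fractional u x" "t \<in> fractional u y"
        and gt: "x t < sum u ({i. x i < y i} - {t})"
        by (auto simp: unobstructed_def)
      \<comment> \<open>If \<open>t\<close> were \<open>i\<close>, the rising rows would be 0 in
        \<open>x\<close> and lie wholly in the other column, whose sum \<open>s'\<close> is at most
        \<open>u t\<close>; their total would then be at most \<open>x t\<close>.\<close>
      have "t \<noteq> i"
      proof
        assume [simp]: "t = i"
        let ?U = "{i. x i < y i} - {t}"
        have "x j = 0" if "j \<in> ?U" for j
          using that slice_vertex_not_fractional[OF x, of j] slice_vertex_unique_fractional[OF x t(1), of j]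
            slice_vertex_bounds[OF y, of j] by auto
        then have "sum u ?U = sum ?x ?U" by (intro sum.cong) auto
        also have "\<dots> \<le> sum ?x (UNIV - {t})"
          using slice_vertex_bounds[OF x] by (intro sum_mono2) auto
        also have "\<dots> = s' - (u t - x t)" using refl(3) by (simp add: sum_diff1)
        finally show False using gt ij by simp
      qed
      then have "i \<notin> ?F" using common[OF t] A by auto
      then have "?F \<subseteq> UNIV - {i}" by auto
      then have "card ?F \<le> card (UNIV - {i})" by (intro card_mono) auto
      then have le: "card ?F \<le> CARD('a) - 1" by simp
      obtain m where m: "m \<le> card ?F" "(x, y) \<in> slice_adj u ^^ m"
        using slice_distance[OF x y eq] by blast
      with le show ?thesis by (intro exI[of _ m]) auto
    qed
    then obtain m where "m \<le> CARD('a) - 1" "(x, y) \<in> slice_adj u ^^ m" by auto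
    moreover from this have "m + 1 \<le> CARD('a)"
      using zero_less_card_finite[where 'a='a] by linarith
    ultimately show ?thesis using A B by (intro exI[of _ m]) simp
  qed
qed

subsection \<open>Dimension and facets\<close>

definition two_columns :: "real ^ 'p \<Rightarrow> real ^ 'p \<Rightarrow> real ^ 2 ^ 'p" where
  "two_columns u y = (\<chi> i j. if j = 1 then y $ i else u $ i - y $ i)"

definition box_slice :: "real ^ 'p \<Rightarrow> real \<Rightarrow> (real ^ 'p) set" where
  "box_slice u s = cbox 0 u \<inter> {y. (\<chi> i. 1) \<bullet> y = s}"

lemma all_ones_inner: "(\<chi> i. 1) \<bullet> y = (\<Sum>i\<in>UNIV. y $ i)" for y :: "real ^ 'p"
  by (simp add: inner_vec_def)

text \<open>The row sums determine the second column, and its sum is right because the totals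
  agree.\<close>

lemma mem_transportation_polytope_2:
  fixes u :: "real ^ 'p" and v :: "real ^ 2"
  assumes "sum (($) u) UNIV = v $ 1 + v $ 2"
  shows "x \<in> transportation_polytope u v \<longleftrightarrow>
    (\<forall>i. 0 \<le> x $ i $ 1 \<and> x $ i $ 1 \<le> u $ i \<and> x $ i $ 2 = u $ i - x $ i $ 1) \<and>
    (\<Sum>i\<in>UNIV. x $ i $ 1) = v $ 1"
proof -
  have "(\<Sum>i\<in>UNIV. x $ i $ 2) = v $ 2"
    if "\<forall>i. x $ i $ 2 = u $ i - x $ i $ 1" "(\<Sum>i\<in>UNIV. x $ i $ 1) = v $ 1"
    using that assms by (simp add: sum_subtractf)
  moreover have "a + b = c \<longleftrightarrow> b = c - a" for a b c :: real by auto
  ultimately show ?thesis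
    unfolding transportation_polytope_def mem_Collect_eq forall_2 sum_2
    by (smt (verit, best))
qed

lemma transportation_polytope_total:
  fixes u :: "real ^ 'p" and v :: "real ^ 2"
  assumes "transportation_polytope u v \<noteq> {}"
  shows "sum (($) u) UNIV = v $ 1 + v $ 2"
proof -
  obtain x where "x \<in> transportation_polytope u v" using assms by blast
  then have r: "x $ i $ 1 + x $ i $ 2 = u $ i" and c: "(\<Sum>i\<in>UNIV. x $ i $ j) = v $ j" for i j
    by (simp_all add: transportation_polytope_def sum_2)
  show ?thesis unfolding c[symmetric] r[symmetric] by (simp add: sum.distrib)
qed

lemma mem_box_slice: "y \<in> box_slice u s \<longleftrightarrow> (\<forall>i. 0 \<le> y $ i \<and> y $ i \<le> u $ i) \<and> (\<Sum>i\<in>UNIV. y $ i) = s"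
  by (auto simp: box_slice_def mem_box_cart all_ones_inner)

text \<open>The predicate \<open>\<phi>\<close> covers both the whole polytope and its subsets on
  which one entry is fixed.\<close>

lemma two_columns_image:
  fixes u :: "real ^ 'p" and v :: "real ^ 2"
  assumes "sum (($) u) UNIV = v $ 1 + v $ 2"
  shows "{x \<in> transportation_polytope u v. \<phi> (\<chi> i. x $ i $ 1)} = two_columns u ` {y \<in> box_slice u (v $ 1). \<phi> y}"
proof (rule set_eqI)
  fix x
  have *: "x = two_columns u (\<chi> i. x $ i $ 1)" if "x \<in> transportation_polytope u v"
    using that mem_transportation_polytope_2[OF assms, of x]
    by (simp add: two_columns_def vec_eq_iff forall_2)
  have "two_columns u y \<in> transportation_polytope u v \<longleftrightarrow> y \<in> box_slice u (v $ 1)" for y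
    by (simp add: mem_transportation_polytope_2[OF assms] mem_box_slice two_columns_def)
  moreover have "(\<chi> i. two_columns u y $ i $ 1) = y" for y
    by (simp add: two_columns_def vec_eq_iff)
  ultimately show "x \<in> {x \<in> transportation_polytope u v. \<phi> (\<chi> i. x $ i $ 1)} \<longleftrightarrow>
      x \<in> two_columns u ` {y \<in> box_slice u (v $ 1). \<phi> y}"
    using * by (auto simp: image_iff) metis+
qed

text \<open>Being a translated injective linear map, \<open>two_columns u\<close> preserves
  dimensions and polytopes.\<close>

lemma two_columns_affine:
  fixes u :: "real ^ 'p"
  obtains a f where "linear f" "inj f" "\<And>S. two_columns u ` S = (+) a ` f ` S"
proof -
  define f :: "real ^ 'p \<Rightarrow> real ^ 2 ^ 'p" where "f y = (\<chi> i j. if j = 1 then y $ i else - (y $ i))" for y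
  have "linear f"
    by (rule linearI) (auto simp: f_def vec_eq_iff)
  moreover have "inj f"
    by (auto simp: inj_def f_def vec_eq_iff forall_2)
  moreover have "two_columns u y = two_columns u 0 + f y" for y
    by (auto simp: f_def two_columns_def vec_eq_iff forall_2)
  then have "two_columns u ` S = (+) (two_columns u 0) ` f ` S" for S
    unfolding image_image by (intro image_cong refl)
  ultimately show ?thesis by (rule that)
qed

lemma aff_dim_two_columns: "aff_dim (two_columns u ` S) = aff_dim S"
proof -
  obtain a f where "linear f" "inj f" "two_columns u ` S = (+) a ` f ` S"
    using two_columns_affine[of u] by metis
  then show ?thesis by (simp add: aff_dim_translation_eq)
qed

lemma polytope_transportation_polytope_2:
  fixes u :: "real ^ 'p" and v :: "real ^ 2"
  assumes "sum (($) u) UNIV = v $ 1 + v $ 2"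
  shows "polytope (transportation_polytope u v)"
proof -
  have "polytope (box_slice u (v $ 1))"
    unfolding box_slice_def
    by (intro polytope_Int_polyhedron polytope_interval polyhedron_hyperplane)
  moreover have "transportation_polytope u v = two_columns u ` box_slice u (v $ 1)"
    using two_columns_image[OF assms, of "\<lambda>_. True"] by simp
  moreover obtain a f where "linear f" "\<And>S. two_columns u ` S = (+) a ` f ` S"
    using two_columns_affine[of u] by metis
  ultimately show ?thesis
    by (simp add: polytope_translation_eq polytope_linear_image)
qed

section \<open>Dimensions of the slice and of its facets\<close>

lemma aff_dim_sandwich:
  assumes "convex S" "open T" "S \<inter> T \<noteq> {}" "S \<inter> T \<subseteq> C" "C \<subseteq> S"
  shows "aff_dim C = aff_dim S"
  using aff_dim_convex_Int_open[OF assms(1-3)] aff_dim_subset[OF assms(4)] aff_dim_subset[OF assms(5)]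
  by simp

lemma aff_dim_box_slice:
  fixes u :: "real ^ 'p"
  assumes u: "positive_vec u" and s: "0 < s" "s < sum (($) u) UNIV"
  shows "aff_dim (box_slice u s) = int CARD('p) - 1"
proof -
  let ?S = "{y :: real ^ 'p. (\<chi> i. 1) \<bullet> y = s}"
  \<comment> \<open>\<open>u\<close> scaled down to the sum \<open>s\<close>; the factor lies
    strictly between 0 and 1, so the point is interior to the box.\<close>
  let ?w = "\<chi> i. u $ i * (s / sum (($) u) UNIV)"
  have "(\<Sum>i\<in>UNIV. ?w $ i) = s"
    using s by (simp flip: sum_distrib_right sum_divide_distrib)
  moreover have "0 < s / sum (($) u) UNIV" "s / sum (($) u) UNIV < 1"
    using s by auto
  then have "0 < ?w $ i \<and> ?w $ i < u $ i" for i
    using u by (simp add: positive_vec_def del: times_divide_eq_right)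
  ultimately have "?w \<in> ?S \<inter> box 0 u"
    by (simp only: Int_iff mem_Collect_eq mem_box_cart all_ones_inner zero_index simp_thms)
  then have ne: "?S \<inter> box 0 u \<noteq> {}" by blast
  \<comment> \<open>The hyperplane meets the open box, so cutting it with the box does not lower its
    dimension.\<close>
  have "aff_dim (box_slice u s) = aff_dim ?S"
    by (rule aff_dim_sandwich[OF _ open_box ne])
      (auto simp: convex_hyperplane box_slice_def mem_box_cart less_imp_le)
  also have "\<dots> = int CARD('p) - 1"
    by (subst aff_dim_hyperplane) (auto simp: vec_eq_iff)
  finally show ?thesis .
qed

text \<open>Used with \<open>c\<close> a bound of coordinate \<open>i\<close>; the hypotheses let
  the remaining sum be spread strictly inside the other coordinates, in proportion to
  \<open>u\<close>. The point in the second claim serves to tell facets apart.\<close>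

lemma box_slice_facet:
  fixes u :: "real ^ 'p"
  assumes u: "positive_vec u" and s: "0 < s - c" "s - c < sum (($) u) (UNIV - {i})" and c: "0 \<le> c" "c \<le> u $ i"
  shows "aff_dim {y \<in> box_slice u s. y $ i = c} = int CARD('p) - 2"
    and "\<exists>w\<in>box_slice u s. w $ i = c \<and> (\<forall>k. k \<noteq> i \<longrightarrow> 0 < w $ k \<and> w $ k < u $ k)"
proof -
  define r where "r = (s - c) / sum (($) u) (UNIV - {i})"
  have r: "0 < r" "r < 1" using s by (auto simp: r_def)
  define w where "w = (\<chi> k. if k = i then c else u $ k * r)"
  have wi: "w $ i = c" by (simp add: w_def)
  have wk: "0 < w $ k \<and> w $ k < u $ k" if "k \<noteq> i" for k
    using that r u by (simp add: w_def positive_vec_def)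
  have "(\<Sum>k\<in>UNIV - {i}. w $ k) = (\<Sum>k\<in>UNIV - {i}. u $ k * r)"
    by (intro sum.cong) (auto simp: w_def)
  also have "\<dots> = s - c"
    unfolding sum_distrib_right[symmetric] r_def using s by simp
  finally have ws: "(\<Sum>k\<in>UNIV. w $ k) = s"
    using wi by (simp add: sum_diff1)
  have w: "w \<in> box_slice u s"
    unfolding mem_box_slice
  proof (intro conjI allI)
    fix k
    show "0 \<le> w $ k" "w $ k \<le> u $ k"
      using wi wk[of k] c by (cases "k = i"; simp)+
  qed (rule ws)
  show "\<exists>w\<in>box_slice u s. w $ i = c \<and> (\<forall>k. k \<noteq> i \<longrightarrow> 0 < w $ k \<and> w $ k < u $ k)"
    by (rule bexI[OF _ w]) (use wi wk in simp)
  let ?S = "{y :: real ^ 'p. (\<chi> i. 1) \<bullet> y = s}" and ?H = "{y :: real ^ 'p. axis i 1 \<bullet> y = c}"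
  \<comment> \<open>Coordinate \<open>i\<close> gets room on both sides of \<open>c\<close>: this
    value may be a bound of the box, and an open set around \<open>w\<close> is needed.\<close>
  let ?T = "box (\<chi> k. if k = i then c - 1 else 0) (\<chi> k. if k = i then c + 1 else u $ k)"
  have wSH: "w \<in> ?S \<inter> ?H" using ws wi by (simp add: all_ones_inner inner_axis')
  moreover have "w \<in> ?T"
    using wi wk by (auto simp: mem_box_cart)
  ultimately have ne: "(?S \<inter> ?H) \<inter> ?T \<noteq> {}" by blast
  have "aff_dim {y \<in> box_slice u s. y $ i = c} = aff_dim (?S \<inter> ?H)"
  proof (rule aff_dim_sandwich[OF _ open_box ne])
    show "convex (?S \<inter> ?H)" by (simp add: convex_Int convex_hyperplane)
    show "{y \<in> box_slice u s. y $ i = c} \<subseteq> ?S \<inter> ?H"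
      by (auto simp: box_slice_def inner_axis')
    show "?S \<inter> ?H \<inter> ?T \<subseteq> {y \<in> box_slice u s. y $ i = c}"
    proof
      fix y assume y: "y \<in> ?S \<inter> ?H \<inter> ?T"
      then have "y $ i = c" by (simp add: inner_axis')
      then have "0 \<le> y $ k \<and> y $ k \<le> u $ k" for k
        using y c by (cases "k = i") (auto simp: mem_box_cart less_imp_le dest!: spec[of _ k])
      then show "y \<in> {y \<in> box_slice u s. y $ i = c}"
        using y by (auto simp: box_slice_def mem_box_cart inner_axis')
    qed
  qed
  also have "\<dots> = aff_dim ?S - 1"
  proof -
    have "UNIV - {i} \<noteq> {}"
    proof
      assume "UNIV - {i} = {}"
      then have "sum (($) u) (UNIV - {i}) = 0" by (simp only: sum.empty)
      then show False using s by linarith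
    qed
    then obtain k where "k \<noteq> i" by blast
    \<comment> \<open>Exchanging one unit between \<open>i\<close> and another row keeps the sum but
      leaves \<open>?H\<close>, so \<open>?H\<close> cuts the dimension by exactly one.\<close>
    then have "w + axis i 1 - axis k 1 \<in> ?S" "w + axis i 1 - axis k 1 \<notin> ?H"
      using wSH by (auto simp: inner_add_right inner_diff_right inner_axis inner_axis_axis)
        (simp add: axis_def)
    then have "\<not> ?S \<subseteq> ?H" by blast
    then show ?thesis
      using wSH by (subst aff_dim_affine_Int_hyperplane) (auto simp: affine_hyperplane)
  qed
  also have "aff_dim ?S = int CARD('p) - 1"
    by (subst aff_dim_hyperplane) (auto simp: vec_eq_iff)
  finally show "aff_dim {y \<in> box_slice u s. y $ i = c} = int CARD('p) - 2" by simp
qed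

text \<open>If entry \<open>(i, j)\<close> is 0, all of \<open>u $ i\<close> goes to the other
  column; the strict inequality leaves room there, so the other rows can be positive in both
  columns.\<close>

lemma entry_facet:
  fixes u :: "real ^ 'p" and v :: "real ^ 2" and j :: 2
  assumes u: "positive_vec u" and v: "positive_vec v" and total: "sum (($) u) UNIV = v $ 1 + v $ 2"
    and less: "u $ i < (if j = 1 then v $ 2 else v $ 1)"
  defines "F \<equiv> {x \<in> transportation_polytope u v. x $ i $ j = 0}"
  shows "F facet_of transportation_polytope u v"
    and "\<exists>w\<in>F. \<forall>k l. w $ k $ l = 0 \<longrightarrow> k = i \<and> l = j"
proof -
  let ?P = "transportation_polytope u v" and ?c = "if j = 1 then 0 else u $ i"
  have v12: "0 < v $ 1" "0 < v $ 2" using v by (auto simp: positive_vec_def)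
  have ui: "0 < u $ i" using u by (simp add: positive_vec_def)
  have j: "j = 1 \<or> j = 2" by (rule exhaust_2)
  have s: "0 < v $ 1 - ?c" "v $ 1 - ?c < sum (($) u) (UNIV - {i})"
    using less v12 total by (auto simp: sum_diff1 split: if_splits)
  have c: "0 \<le> ?c" "?c \<le> u $ i" using ui by auto
  have "x $ i $ j = 0 \<longleftrightarrow> x $ i $ 1 = ?c" if "x \<in> ?P" for x
    using j that mem_transportation_polytope_2[OF total, of x] by auto
  then have "F = {x \<in> ?P. (\<chi> i. x $ i $ 1) $ i = ?c}"
    unfolding F_def vec_lambda_beta by blast
  then have F: "F = two_columns u ` {y \<in> box_slice u (v $ 1). y $ i = ?c}"
    using two_columns_image[OF total, of "\<lambda>y. y $ i = ?c"] by simp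
  have "?P = two_columns u ` box_slice u (v $ 1)"
    using two_columns_image[OF total, of "\<lambda>_. True"] by simp
  then have dimP: "aff_dim ?P = int CARD('p) - 1"
    using aff_dim_box_slice[OF u, of "v $ 1"] total v12 by (simp add: aff_dim_two_columns)
  have dimF: "aff_dim F = int CARD('p) - 2"
    unfolding F aff_dim_two_columns by (rule box_slice_facet(1)[OF u s c])
  obtain y where y: "y \<in> box_slice u (v $ 1)" "y $ i = ?c"
    "\<And>k. k \<noteq> i \<Longrightarrow> 0 < y $ k \<and> y $ k < u $ k"
    using box_slice_facet(2)[OF u s c] by blast
  have w: "two_columns u y \<in> F" using y F by blast
  have "F = ?P \<inter> {x. axis i (axis j 1) \<bullet> x = 0}"
    by (auto simp: F_def inner_axis')
  moreover have "convex ?P"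
    by (rule polytope_imp_convex[OF polytope_transportation_polytope_2[OF total]])
  moreover have "0 \<le> axis i (axis j 1) \<bullet> x" if "x \<in> ?P" for x
    using that by (simp add: inner_axis' transportation_polytope_def)
  ultimately have "F face_of ?P"
    by (metis face_of_Int_supporting_hyperplane_ge)
  then show "F facet_of ?P"
    using w dimP dimF by (auto simp: facet_of_def)
  have "k = i \<and> l = j" if "two_columns u y $ k $ l = 0" for k l
  proof -
    have "k = i"
      using that y(3)[of k] by (auto simp: two_columns_def split: if_splits)
    moreover have "l = 1 \<or> l = 2" by (rule exhaust_2)
    ultimately show ?thesis
      using that j y(2) ui by (auto simp: two_columns_def split: if_splits)
  qed
  with w show "\<exists>w\<in>F. \<forall>k l. w $ k $ l = 0 \<longrightarrow> k = i \<and> l = j" by blast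
qed

text \<open>The facet of an entry contains a point at which no other entry vanishes, so different
  entries give different facets.\<close>

lemma card_facets_ge:
  fixes u :: "real ^ 'p" and v :: "real ^ 2"
  assumes u: "positive_vec u" and v: "positive_vec v" and total: "sum (($) u) UNIV = v $ 1 + v $ 2"
  shows "card {i. u $ i < v $ 2} + card {i. u $ i < v $ 1} \<le> card {F. F facet_of transportation_polytope u v}"
proof -
  let ?P = "transportation_polytope u v"
  let ?N = "{i. u $ i < v $ 2} \<times> {1 :: 2} \<union> {i. u $ i < v $ 1} \<times> {2}"
  define g where "g = (\<lambda>(i, j). {x \<in> ?P. x $ i $ j = 0})"
  have N: "u $ fst q < (if snd q = 1 then v $ 2 else v $ 1)" if "q \<in> ?N" for q
    using that by auto
  have "inj_on g ?N"
  proof (rule inj_onI)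
    fix q q' assume q: "q \<in> ?N" "q' \<in> ?N" "g q = g q'"
    obtain w where "w \<in> g q" and w: "\<And>k l. w $ k $ l = 0 \<Longrightarrow> k = fst q \<and> l = snd q"
      using entry_facet(2)[OF u v total N[OF q(1)]] by (auto simp: g_def case_prod_unfold)
    then have "w $ fst q' $ snd q' = 0"
      using q(3) by (auto simp: g_def case_prod_unfold)
    then show "q = q'"
      using w by (simp add: prod_eq_iff)
  qed
  then have "card (g ` ?N) = card ?N" by (rule card_image)
  also have "\<dots> = card {i. u $ i < v $ 2} + card {i. u $ i < v $ 1}"
    by (subst card_Un_disjoint) (auto simp: card_cartesian_product)
  finally have "card (g ` ?N) = \<dots>" .
  moreover have "g ` ?N \<subseteq> {F. F facet_of ?P}"
    using entry_facet(1)[OF u v total N] by (auto simp: g_def)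
  then have "card (g ` ?N) \<le> card {F. F facet_of ?P}"
    by (intro card_mono finite_polytope_facets polytope_transportation_polytope_2[OF total])
  ultimately show ?thesis by simp
qed

subsection \<open>Vertices, edges and distances\<close>

abbreviation first_column :: "real ^ 2 ^ 'p \<Rightarrow> 'p \<Rightarrow> real" where
  "first_column x \<equiv> \<lambda>i. x $ i $ 1"

lemma first_column_inject:
  fixes u :: "real ^ 'p" and v :: "real ^ 2"
  assumes "sum (($) u) UNIV = v $ 1 + v $ 2"
    and "x \<in> transportation_polytope u v" "y \<in> transportation_polytope u v"
    and "first_column x = first_column y"
  shows "x = y"
  using assms(2-4) unfolding mem_transportation_polytope_2[OF assms(1)] vec_eq_iff forall_2
  by (metis (no_types))

lemma sum_eq_agree_off_pair:
  fixes f g :: "'a::finite \<Rightarrow> real"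
  assumes "sum f UNIV = sum g UNIV" "\<And>j. j \<noteq> i \<Longrightarrow> j \<noteq> k \<Longrightarrow> f j = g j" "f i = g i"
  shows "f = g"
proof -
  have "sum f (UNIV - {k}) = sum g (UNIV - {k})"
    by (intro sum.cong refl) (metis DiffE assms(2,3) singletonI)
  then have "f k = g k" using assms(1) by (simp add: sum_diff1)
  then show ?thesis using assms(2,3) by (metis ext)
qed

text \<open>With positive weights a bound is attained only if both ends attain it; the upper bound
  is reduced to the lower one through \<open>c - a\<close> and \<open>c - b\<close>.\<close>

lemma convex_combination_at_bound:
  fixes a b c t :: real
  assumes "0 < t" "t < 1" "0 \<le> a" "a \<le> c" "0 \<le> b" "b \<le> c"
    and "(1 - t) * a + t * b = 0 \<or> (1 - t) * a + t * b = c"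
  shows "a = (1 - t) * a + t * b \<and> b = (1 - t) * a + t * b"
proof -
  have *: "a' = 0 \<and> b' = 0" if "0 \<le> a'" "0 \<le> b'" "(1 - t) * a' + t * b' = 0" for a' b'
    using that assms(1,2) by (smt (verit) mult_nonneg_nonneg mult_pos_pos)
  from assms(7) show ?thesis
  proof
    assume "(1 - t) * a + t * b = 0"
    with *[of a b] assms show ?thesis by simp
  next
    assume e: "(1 - t) * a + t * b = c"
    then have "(1 - t) * (c - a) + t * (c - b) = 0" by (simp add: algebra_simps)
    with *[of "c - a" "c - b"] assms e show ?thesis by simp
  qed
qed

lemma open_segment_at_bound:
  fixes u :: "real ^ 'p" and v :: "real ^ 2"
  assumes total: "sum (($) u) UNIV = v $ 1 + v $ 2"
    and a: "a \<in> transportation_polytope u v" and b: "b \<in> transportation_polytope u v"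
    and x: "x \<in> open_segment a b" "x $ i $ 1 = 0 \<or> x $ i $ 1 = u $ i"
  shows "a $ i $ 1 = x $ i $ 1" "b $ i $ 1 = x $ i $ 1"
proof -
  obtain t where t: "0 < t" "t < 1" "x = (1 - t) *\<^sub>R a + t *\<^sub>R b"
    using x(1) by (auto simp: in_segment)
  have "x $ i $ 1 = (1 - t) * a $ i $ 1 + t * b $ i $ 1"
    by (simp add: t(3))
  then show "a $ i $ 1 = x $ i $ 1" "b $ i $ 1 = x $ i $ 1"
    using convex_combination_at_bound[OF t(1,2), of "a $ i $ 1" "u $ i" "b $ i $ 1"] a b x(2)
    unfolding mem_transportation_polytope_2[OF total] by auto
qed

lemma extreme_point_of_transportation_polytope_2:
  fixes u :: "real ^ 'p" and v :: "real ^ 2"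
  assumes total: "sum (($) u) UNIV = v $ 1 + v $ 2"
  defines "P \<equiv> transportation_polytope u v"
  shows "x extreme_point_of P \<longleftrightarrow> x \<in> P \<and> slice_vertex (($) u) (first_column x)"
proof (intro iffI conjI)
  assume ext: "x extreme_point_of P"
  then show xP: "x \<in> P" by (simp add: extreme_point_of_def)
  note mem = mem_transportation_polytope_2[OF total, folded P_def]
  show "slice_vertex (($) u) (first_column x)"
    unfolding slice_vertex_def
  proof (intro conjI allI ballI)
    fix i show "0 \<le> x $ i $ 1" "x $ i $ 1 \<le> u $ i" using xP mem by auto
  next
    fix i k assume ik: "i \<in> fractional (($) u) (first_column x)" "k \<in> fractional (($) u) (first_column x)"
    show "i = k"
    proof (rule ccontr)
      assume ne: "i \<noteq> k"
      \<comment> \<open>The smallest distance of the two coordinates to their bounds: shifting this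
        amount between them in either direction stays in \<open>P\<close>, with \<open>x\<close> as
        the midpoint.\<close>
      define \<epsilon> where "\<epsilon> = Min {x $ i $ 1, u $ i - x $ i $ 1, x $ k $ 1, u $ k - x $ k $ 1}"
      have \<epsilon>: "0 < \<epsilon>" "\<epsilon> \<le> x $ i $ 1" "\<epsilon> \<le> u $ i - x $ i $ 1" "\<epsilon> \<le> x $ k $ 1" "\<epsilon> \<le> u $ k - x $ k $ 1"
        using ik by (auto simp: \<epsilon>_def fractional_def)
      define e :: "'p \<Rightarrow> real" where "e = (\<lambda>a. (if a = i then \<epsilon> else 0) - (if a = k then \<epsilon> else 0))"
      define d :: "real ^ 2 ^ 'p" where "d = (\<chi> a b. if b = 1 then e a else - e a)"
      have sume: "sum e UNIV = 0" by (simp add: e_def sum_subtractf)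
      have ab: "\<bar>e a\<bar> \<le> x $ a $ 1 \<and> \<bar>e a\<bar> \<le> u $ a - x $ a $ 1" for a
      proof -
        have "0 \<le> x $ a $ 1" "x $ a $ 1 \<le> u $ a" using xP mem by auto
        then show ?thesis using \<epsilon> ne by (auto simp: e_def)
      qed
      have "x + r *\<^sub>R d \<in> P" if r: "r = 1 \<or> r = -1" for r
        unfolding mem
      proof (intro conjI allI)
        fix a
        show "0 \<le> (x + r *\<^sub>R d) $ a $ 1" "(x + r *\<^sub>R d) $ a $ 1 \<le> u $ a"
          using ab[of a] r by (auto simp: d_def abs_le_iff)
        show "(x + r *\<^sub>R d) $ a $ 2 = u $ a - (x + r *\<^sub>R d) $ a $ 1"
          using xP mem by (simp add: d_def)
      next
        show "(\<Sum>a\<in>UNIV. (x + r *\<^sub>R d) $ a $ 1) = v $ 1"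
          using xP mem sume by (simp add: d_def sum.distrib flip: sum_distrib_left)
      qed
      from this[of 1] this[of "-1"] have "x + d \<in> P" "x - d \<in> P" by auto
      moreover have "(x - d) $ i $ 1 \<noteq> (x + d) $ i $ 1" using \<epsilon> ne by (simp add: d_def e_def)
      then have "x - d \<noteq> x + d" by metis
      then have "midpoint (x - d) (x + d) \<in> open_segment (x - d) (x + d)" by simp
      moreover have "midpoint (x - d) (x + d) = x"
        by (simp add: midpoint_def flip: scaleR_2)
      ultimately show False using ext by (auto simp: extreme_point_of_def)
    qed
  qed
next
  assume x: "x \<in> P \<and> slice_vertex (($) u) (first_column x)"
  note mem = mem_transportation_polytope_2[OF total, folded P_def]
  show "x extreme_point_of P"
    unfolding extreme_point_of_def
  proof (intro conjI ballI notI)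
    show "x \<in> P" using x by blast
    fix a b assume ab: "a \<in> P" "b \<in> P" "x \<in> open_segment a b"
    \<comment> \<open>\<open>t\<close> is the fractional coordinate, or arbitrary if there is none.
      The others are fixed by their bounds, and then the sum fixes \<open>t\<close>.\<close>
    obtain t where t: "\<And>j. j \<noteq> t \<Longrightarrow> j \<notin> fractional (($) u) (first_column x)"
      using x slice_vertex_unique_fractional by metis
    have bd: "x $ j $ 1 = 0 \<or> x $ j $ 1 = u $ j" if "j \<noteq> t" for j
      using slice_vertex_not_fractional[of "($) u" "first_column x" j] x t[OF that] by blast
    note seg = open_segment_at_bound[OF total ab[unfolded P_def]]
    have "first_column c = first_column x"
      if "c \<in> P" "\<And>j. j \<noteq> t \<Longrightarrow> c $ j $ 1 = x $ j $ 1" for c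
    proof -
      have "sum (first_column c) (UNIV - {t}) = sum (first_column x) (UNIV - {t})"
        using that(2) by (intro sum.cong) auto
      then have "c $ t $ 1 = x $ t $ 1"
        using that(1) x mem by (simp add: sum_diff1)
      then show ?thesis using that(2) by (metis ext)
    qed
    then have "a = x" "b = x"
      using ab(1,2) x seg bd first_column_inject[OF total, folded P_def] by blast+
    then show False using ab(3) by simp
  qed
qed


text \<open>Points of \<open>P\<close> that agree with \<open>x\<close> off \<open>i\<close> and
  \<open>k\<close> lie on the line through \<open>x\<close> and \<open>y\<close> and, as both are
  vertices, between them. The other coordinates are at bounds, so every segment of \<open>P\<close>
  through such a point keeps them fixed; this gives a face.\<close>

lemma closed_segment_edge_of_transportation_polytope_2:
  fixes u :: "real ^ 'p" and v :: "real ^ 2"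
  assumes total: "sum (($) u) UNIV = v $ 1 + v $ 2"
  defines "P \<equiv> transportation_polytope u v"
  assumes x: "x \<in> P" and y: "y \<in> P" and adj: "(first_column x, first_column y) \<in> slice_adj (($) u)"
  shows "closed_segment x y edge_of P"
proof -
  note mem = mem_transportation_polytope_2[OF total, folded P_def]
  note inject = first_column_inject[OF total, folded P_def]
  have ext: "x extreme_point_of P" "y extreme_point_of P"
    using x y adj extreme_point_of_transportation_polytope_2[OF total, folded P_def]
    by (auto simp: slice_adj_def)
  obtain i k where ik: "free_coords (($) u) (first_column x) (first_column y) \<subseteq> {i, k}"
    and ne: "first_column x \<noteq> first_column y"
    using adj by (auto simp: slice_adj_def)
  have xy: "y $ j $ 1 = x $ j $ 1" and bd: "x $ j $ 1 = 0 \<or> x $ j $ 1 = u $ j"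
    if "j \<noteq> i" "j \<noteq> k" for j
  proof -
    have j: "j \<notin> free_coords (($) u) (first_column x) (first_column y)" using ik that by blast
    then show "y $ j $ 1 = x $ j $ 1" by (simp add: free_coords_def)
    show "x $ j $ 1 = 0 \<or> x $ j $ 1 = u $ j"
      using j adj slice_vertex_not_fractional[of "($) u" "first_column x" j]
      by (auto simp: free_coords_def slice_adj_def)
  qed
  have sums: "sum (first_column a) UNIV = v $ 1" if "a \<in> P" for a
    using that mem by simp
  have xyi: "x $ i $ 1 \<noteq> y $ i $ 1"
  proof
    assume "x $ i $ 1 = y $ i $ 1"
    then have "first_column x = first_column y"
      using sum_eq_agree_off_pair[of "first_column x" "first_column y" i k] sums[OF x] sums[OF y] xy by simp
    with ne show False by contradiction
  qed
  have line: "w \<in> closed_segment x y"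
    if w: "w \<in> P" "\<And>j. j \<noteq> i \<Longrightarrow> j \<noteq> k \<Longrightarrow> w $ j $ 1 = x $ j $ 1" for w
  proof -
    define \<tau> where "\<tau> = (w $ i $ 1 - x $ i $ 1) / (y $ i $ 1 - x $ i $ 1)"
    let ?f = "\<lambda>j. x $ j $ 1 + \<tau> * (y $ j $ 1 - x $ j $ 1)"
    have "first_column w = ?f"
    proof (rule sum_eq_agree_off_pair[where i = i and k = k])
      show "sum (first_column w) UNIV = sum ?f UNIV"
        using sums[OF w(1)] sums[OF x] sums[OF y]
        by (simp add: sum.distrib sum_subtractf flip: sum_distrib_left)
      show "w $ i $ 1 = ?f i" using xyi by (simp add: \<tau>_def)
    qed (use w(2) xy in auto)
    then have col1: "w $ j $ 1 = ?f j" for j by (rule fun_cong)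
    have "w $ j $ 2 = x $ j $ 2 + \<tau> * (y $ j $ 2 - x $ j $ 2)" for j
    proof -
      have e: "w $ j $ 2 = u $ j - w $ j $ 1" "x $ j $ 2 = u $ j - x $ j $ 1" "y $ j $ 2 = u $ j - y $ j $ 1"
        using x y w(1) mem by auto
      show ?thesis unfolding e col1[of j] by (simp add: algebra_simps)
    qed
    with col1 have w_eq: "w = x + \<tau> *\<^sub>R (y - x)"
      by (simp add: vec_eq_iff forall_2)
    have "x = x + 0 *\<^sub>R (y - x)" "y = x + 1 *\<^sub>R (y - x)" by simp_all
    with w_eq have "\<forall>p\<in>{w, x, y}. \<exists>c. p = x + c *\<^sub>R (y - x)"
      by blast
    then have "collinear {w, x, y}"
      unfolding collinear_alt by blast
    then consider "w \<in> closed_segment x y" | "x \<in> closed_segment y w" | "y \<in> closed_segment w x"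
      unfolding collinear_between_cases between_mem_segment by blast
    then show ?thesis
    proof cases
      case 2
      then have "x = y \<or> x = w"
        using ext(1) y w(1) by (auto simp: extreme_point_of_def closed_segment_eq_open)
      then show ?thesis using ne by auto
    next
      case 3
      then have "y = w \<or> y = x"
        using ext(2) x w(1) by (auto simp: extreme_point_of_def closed_segment_eq_open)
      then show ?thesis using ne by auto
    qed
  qed
  have conv: "convex P"
    unfolding P_def by (rule polytope_imp_convex[OF polytope_transportation_polytope_2[OF total]])
  have "closed_segment x y face_of P"
    unfolding face_of_def
  proof (intro conjI ballI impI convex_closed_segment)
    show sub: "closed_segment x y \<subseteq> P" using conv x y by (rule closed_segment_subset[rotated 2])
    fix a b z assume ab: "a \<in> P" "b \<in> P" and z: "z \<in> closed_segment x y" "z \<in> open_segment a b"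
    obtain t where "z = (1 - t) *\<^sub>R x + t *\<^sub>R y" using z(1) by (auto simp: in_segment)
    then have "z $ j $ 1 = x $ j $ 1" if "j \<noteq> i" "j \<noteq> k" for j
      using xy[OF that] by (simp add: left_diff_distrib)
    then have "a $ j $ 1 = x $ j $ 1 \<and> b $ j $ 1 = x $ j $ 1" if "j \<noteq> i" "j \<noteq> k" for j
      using open_segment_at_bound[OF total ab[unfolded P_def] z(2), of j] bd[OF that] that by simp
    then show "a \<in> closed_segment x y" "b \<in> closed_segment x y"
      using line ab by blast+
  qed
  moreover have "aff_dim (closed_segment x y) = 1"
    using ne by (auto simp: segment_convex_hull aff_dim_convex_hull)
  ultimately show ?thesis by (simp add: edge_of_def)
qed

section \<open>Walks in the graph of the polytope\<close>

definition edge_rel :: "'a::euclidean_space set \<Rightarrow> ('a \<times> 'a) set" where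
  "edge_rel P = {(x, y). x extreme_point_of P \<and> y extreme_point_of P \<and> closed_segment x y edge_of P}"

text \<open>\<open>\<mu>\<close> is an infimum over walks. The assumption on \<open>x\<close>
  provides the node at which the empty walk for \<open>m = 0\<close> sits.\<close>

lemma polytope_graph_distance_le:
  assumes "x extreme_point_of P" "(x, y) \<in> edge_rel P ^^ m"
  shows "wf_digraph.\<mu> (polytope_graph P) (\<lambda>_. 1) x y \<le> ereal (real m)"
proof -
  interpret wf_digraph "polytope_graph P"
    by unfold_locales (auto simp: polytope_graph_def)
  have "\<exists>p. awalk x p y \<and> awalk_cost (\<lambda>_. 1) p = real m"
    using assms
  proof (induction m arbitrary: x)
    case 0
    then have "x \<in> verts (polytope_graph P)" "x = y" by (auto simp: polytope_graph_def)
    then have "awalk x [] y" by (simp add: awalk_Nil_iff)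
    then show ?case by fastforce
  next
    case (Suc m)
    from Suc.prems(2) obtain z where z: "(x, z) \<in> edge_rel P" "(z, y) \<in> edge_rel P ^^ m"
      using relpow_Suc_D2 by meson
    then obtain p where p: "awalk z p y" "awalk_cost (\<lambda>_. 1) p = real m"
      using Suc.IH[of z] by (auto simp: edge_rel_def)
    have "(x, z) \<in> arcs (polytope_graph P)" "tail (polytope_graph P) (x, z) = x"
      "head (polytope_graph P) (x, z) = z"
      using z(1) by (simp_all add: polytope_graph_def edge_rel_def)
    then have "awalk x ((x, z) # p) y" using p(1) by (simp add: awalk_Cons_iff)
    moreover have "awalk_cost (\<lambda>_. 1) ((x, z) # p) = real (Suc m)" using p(2) by simp
    ultimately show ?case by blast
  qed
  then show ?thesis by (metis min_cost_le_walk_cost)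
qed

lemma slice_walk_lifts:
  fixes u :: "real ^ 'p" and v :: "real ^ 2"
  assumes total: "sum (($) u) UNIV = v $ 1 + v $ 2"
  defines "P \<equiv> transportation_polytope u v"
  assumes "x \<in> P" "y \<in> P" "(first_column x, first_column y) \<in> slice_adj (($) u) ^^ m"
  shows "(x, y) \<in> edge_rel P ^^ m"
  using assms(3-5)
proof (induction m arbitrary: x)
  case 0
  then have "x = y"
    by (intro first_column_inject[OF total, folded P_def]) auto
  then show ?case by simp
next
  case (Suc m)
  note mem = mem_transportation_polytope_2[OF total, folded P_def]
  from Suc.prems(3) obtain h where h: "(first_column x, h) \<in> slice_adj (($) u)"
    "(h, first_column y) \<in> slice_adj (($) u) ^^ m"
    using relpow_Suc_D2 by meson
  \<comment> \<open>Intermediate slice vertices complete to points of \<open>P\<close>, because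
    \<open>slice_adj\<close> preserves the sum.\<close>
  define z where "z = two_columns u (\<chi> i. h i)"
  have col: "first_column z = h" by (simp add: z_def two_columns_def)
  have hv: "slice_vertex (($) u) h" "sum h UNIV = v $ 1"
    using h(1) Suc.prems(1) mem by (auto simp: slice_adj_def)
  then have z: "z \<in> P"
    unfolding mem using slice_vertex_bounds[OF hv(1)] by (simp add: z_def two_columns_def)
  have adj: "(first_column x, first_column z) \<in> slice_adj (($) u)" using h(1) col by simp
  then have "(x, z) \<in> edge_rel P"
    using closed_segment_edge_of_transportation_polytope_2[OF total, folded P_def, OF Suc.prems(1) z]
      extreme_point_of_transportation_polytope_2[OF total, folded P_def] Suc.prems(1) z
    by (auto simp: edge_rel_def slice_adj_def)
  moreover have "(z, y) \<in> edge_rel P ^^ m"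
    using Suc.IH[OF z Suc.prems(2)] h(2) col by simp
  ultimately show ?case by (rule relpow_Suc_I2)
qed

lemma aff_dim_transportation_polytope_2:
  fixes u :: "real ^ 'p" and v :: "real ^ 2"
  assumes u: "positive_vec u" and v: "positive_vec v" and total: "sum (($) u) UNIV = v $ 1 + v $ 2"
  shows "aff_dim (transportation_polytope u v) = int CARD('p) - 1"
proof -
  have "0 < v $ 1" "0 < v $ 2" using v by (auto simp: positive_vec_def)
  then have "aff_dim (box_slice u (v $ 1)) = int CARD('p) - 1"
    using total by (intro aff_dim_box_slice[OF u]) auto
  then show ?thesis
    using two_columns_image[OF total, of "\<lambda>_. True"] by (simp add: aff_dim_two_columns)
qed

text \<open>Here \<open>P\<close> is a segment on which the strict inequalities counted in \<open>card_facets_ge\<close> may all fail,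
  so that the bound there is useless; the facets are the endpoints.\<close>

lemma two_row_distance:
  fixes u :: "real ^ 'p" and v :: "real ^ 2"
  assumes u: "positive_vec u" and v: "positive_vec v" and total: "sum (($) u) UNIV = v $ 1 + v $ 2"
    and ij: "v $ 2 \<le> u $ i" "v $ 1 \<le> u $ j" "i \<noteq> j"
  defines "P \<equiv> transportation_polytope u v"
  assumes x: "x extreme_point_of P" and y: "y extreme_point_of P"
  shows "\<exists>m. (x, y) \<in> edge_rel P ^^ m \<and> m + CARD('p) \<le> card {F. F facet_of P} + 1"
proof -
  have univ: "UNIV = {i, j}"
  proof (rule ccontr)
    assume "UNIV \<noteq> {i, j}"
    then obtain k where "k \<noteq> i" "k \<noteq> j" by blast
    have "sum (($) u) {i, j, k} \<le> sum (($) u) UNIV"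
      using u by (intro sum_mono2) (auto simp: positive_vec_def less_imp_le)
    moreover have "0 < u $ k" using u by (simp add: positive_vec_def)
    ultimately show False
      using total ij \<open>k \<noteq> i\<close> \<open>k \<noteq> j\<close> by simp
  qed
  have card: "CARD('p) = 2" unfolding univ using ij(3) by simp
  then have dim: "aff_dim P = 1"
    using aff_dim_transportation_polytope_2[OF u v total] by (simp add: P_def)
  have fin: "finite {F. F facet_of P}"
    unfolding P_def by (rule finite_polytope_facets[OF polytope_transportation_polytope_2[OF total]])
  have fac: "{z} facet_of P" if "z extreme_point_of P" for z
    using that dim by (simp add: facet_of_def face_of_singleton)
  show ?thesis
  proof (cases "x = y")
    case True
    have "card {{x}} \<le> card {F. F facet_of P}"
      using fin fac[OF x] by (intro card_mono) auto
    then show ?thesis using True card by (intro exI[of _ 0]) auto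
  next
    case False
    have "card {{x}, {y}} \<le> card {F. F facet_of P}"
      using fin fac[OF x] fac[OF y] by (intro card_mono) auto
    then have "2 \<le> card {F. F facet_of P}" using False by simp
    moreover have vx: "x \<in> P \<and> slice_vertex (($) u) (first_column x)"
      and vy: "y \<in> P \<and> slice_vertex (($) u) (first_column y)"
      using x y extreme_point_of_transportation_polytope_2[OF total] unfolding P_def by blast+
    have "(first_column x, first_column y) \<in> slice_adj (($) u)"
    proof -
      have "sum (first_column x) UNIV = sum (first_column y) UNIV"
        using vx vy mem_transportation_polytope_2[OF total] by (simp add: P_def)
      moreover have "first_column x \<noteq> first_column y"
        using False first_column_inject[OF total] vx vy unfolding P_def by blast
      moreover have "free_coords (($) u) (first_column x) (first_column y) \<subseteq> {i, j}"
        using univ by blast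
      ultimately show ?thesis using vx vy by (auto simp: slice_adj_def)
    qed
    then have "(x, y) \<in> edge_rel P ^^ 1"
      using slice_walk_lifts[OF total, of x y 1] vx vy by (simp add: P_def)
    ultimately show ?thesis using card by (intro exI[of _ 1]) auto
  qed
qed

text \<open>Let \<open>a\<close> and \<open>b\<close> count the rows with
  \<open>v $ 2 \<le> u $ i\<close> and with \<open>v $ 1 \<le> u $ i\<close>. Unless two distinct
  rows satisfy one condition each, \<open>slice_diameter\<close> gives
  \<open>m + a + b \<le> CARD('p) + 1\<close>, and there are at least
  \<open>2 * CARD('p) - a - b\<close> facets; adding up eliminates \<open>a\<close> and
  \<open>b\<close>.\<close>

lemma transportation_polytope_2_distance:
  fixes u :: "real ^ 'p" and v :: "real ^ 2"
  assumes u: "positive_vec u" and v: "positive_vec v" and total: "sum (($) u) UNIV = v $ 1 + v $ 2"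
  defines "P \<equiv> transportation_polytope u v"
  assumes x: "x extreme_point_of P" and y: "y extreme_point_of P"
  shows "\<exists>m. (x, y) \<in> edge_rel P ^^ m \<and> m + CARD('p) \<le> card {F. F facet_of P} + 1"
proof (cases "\<exists>i j. v $ 2 \<le> u $ i \<and> v $ 1 \<le> u $ j \<and> i \<noteq> j")
  case True
  then show ?thesis
    using two_row_distance[OF u v total] x y unfolding P_def by blast
next
  case False
  have vx: "x \<in> P \<and> slice_vertex (($) u) (first_column x)"
    and vy: "y \<in> P \<and> slice_vertex (($) u) (first_column y)"
    using x y extreme_point_of_transportation_polytope_2[OF total] unfolding P_def by blast+
  have sums: "sum (first_column x) UNIV = v $ 1" "sum (first_column y) UNIV = v $ 1"
    using vx vy mem_transportation_polytope_2[OF total] by (simp_all add: P_def)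
  obtain m where m: "m + card {i. v $ 2 \<le> u $ i} + card {i. v $ 1 \<le> u $ i} \<le> CARD('p) + 1"
    "(first_column x, first_column y) \<in> slice_adj (($) u) ^^ m"
    using slice_diameter[OF conjunct2[OF vx] conjunct2[OF vy] sums total] False by blast
  have split: "card {i. c \<le> u $ i} + card {i. u $ i < c} = CARD('p)" for c
  proof -
    have "{i. c \<le> u $ i} \<union> {i. u $ i < c} = UNIV" by auto
    moreover have "{i. c \<le> u $ i} \<inter> {i. u $ i < c} = {}" by auto
    ultimately show ?thesis by (metis card_Un_disjoint finite)
  qed
  have "m + CARD('p) \<le> card {F. F facet_of P} + 1"
    using m(1) split[of "v $ 1"] split[of "v $ 2"] card_facets_ge[OF u v total] unfolding P_def by linarith
  then show ?thesis
    using slice_walk_lifts[OF total, of x y m] vx vy m(2) unfolding P_def by blast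
qed

theorem theorem3p21:
  fixes u :: "real ^ 'p" and v :: "real ^ 2"
    and P :: "(real ^ 2 ^ 'p) set" and n :: nat and d :: int
  assumes "positive_vec u" and "positive_vec v"
    and "P = transportation_polytope u v"
    and "P \<noteq> {}"
    and "n = card {F. F facet_of P}"
    and "n \<le> 2 * CARD('p)"
    and "d = aff_dim P"
  shows "d = int CARD('p) - 1 \<and>
         graph_diameter (polytope_graph P) \<le> ereal (of_int (int n - d))"
proof
  have total: "sum (($) u) UNIV = v $ 1 + v $ 2"
    using assms(3,4) transportation_polytope_total by blast
  show d: "d = int CARD('p) - 1"
    using aff_dim_transportation_polytope_2[OF assms(1,2) total] assms(3,7) by simp
  have "wf_digraph.\<mu> (polytope_graph P) (\<lambda>_. 1) x y \<le> ereal (of_int (int n - d))"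
    if xy: "x extreme_point_of P" "y extreme_point_of P" for x y
  proof -
    obtain m where m: "(x, y) \<in> edge_rel P ^^ m" "m + CARD('p) \<le> n + 1"
      using transportation_polytope_2_distance[OF assms(1,2) total xy[unfolded assms(3)]]
      unfolding assms(5) assms(3) by blast
    have "wf_digraph.\<mu> (polytope_graph P) (\<lambda>_. 1) x y \<le> ereal (real m)"
      using polytope_graph_distance_le xy(1) m(1) by blast
    also have "int m \<le> int n - d" using m(2) d by linarith
    then have "ereal (real m) \<le> ereal (of_int (int n - d))"
      by (metis ereal_less_eq(3) of_int_le_iff of_int_of_nat_eq)
    finally show ?thesis .
  qed
  then show "graph_diameter (polytope_graph P) \<le> ereal (of_int (int n - d))"
    unfolding graph_diameter_def by (auto intro!: SUP_least simp: polytope_graph_def)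
qed

end
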